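(* Let $X$ be a real Banach space with a normalized Schauder basis $(e_n)_{n\in\mathbb N}$ and let $w=(w_n)$ be a weight sequence with $\sum_n w_n=\infty$ and $\sup_n w_n<\infty$. If $(e_n)$ satisfies both $w$-left Property $(A)$ and $w$-right Property $(A)$, then $(e_n)$ satisfies $w$-Property $(A)$.
   Context: Let $(e_n^* )$ be the biorthogonal functionals of $(e_n)$, and $\mathrm{supp}(x)=\{n: e_n^*(x)\ne0\}$. A weight sequence $w=(w_n)_{n\in\mathbb N}$ is a sequence of positive real numbers; $w(A)=\sum_{i\in A}w_i$. $\mathbb N^{<\infty}$ is the set of all finite subsets of $\mathbb N$ (including $\emptyset$). $\mathcal A$ is the set of all sequences $\varepsilon=(\varepsilon_i)_{i\in\mathbb N}$ with $\varepsilon_i\in\{1,-1\}$, and $1_{\varepsilon A}=\sum_{i\in A}\varepsilon_ie_i$ for $A\in\mathbb N^{<\infty}$. $A<B$ means that every element of $A$ is smaller than every element of $B$ (so it holds if $A$ or $B$ is empty). Consider, for a constant $C\ge1$, the inequality $( * )$: $\|x+t1_{\varepsilon A}\|\le C\|x+t1_{\eta B}\|$, for $x\in X$, $t\ge\sup_j|e_j^*(x)|$, $\varepsilon,\eta\in\mathcal A$ and $A,B\in\mathbb N^{<\infty}$ with $w(A)\le w(B)$ and $\mathrm{supp}(x)\cap(A\cup B)=\emptyset$. The basis has $w$-Property $(A)$ if there is $C\ge1$ such that $( * )$ holds for all such data with $A\cap B=\emptyset$; it has $w$-left Property $(A)$ if there is $C\ge1$ such that $( * )$ holds for all such data with $A<B$;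 it has $w$-right Property $(A)$ if there is $C\ge1$ such that $( * )$ holds for all such data with $B<A$. *)

theory Defs
  imports "HOL-Analysis.Analysis"
begin

definition schauder_basis :: "(nat \<Rightarrow> 'a::banach) \<Rightarrow> bool" where
  "schauder_basis e \<longleftrightarrow> (\<forall>x. \<exists>!a :: nat \<Rightarrow> real. (\<lambda>n. a n *\<^sub>R e n) sums x)"

definition normalized :: "(nat \<Rightarrow> 'a::banach) \<Rightarrow> bool" where
  "normalized e \<longleftrightarrow> (\<forall>n. norm (e n) = 1)"

(* biorth e n x is e_n^*(x), the n-th coefficient of x.
   It is meaningful only if e is a Schauder basis. *)
definition biorth :: "(nat \<Rightarrow> 'a::banach) \<Rightarrow> nat \<Rightarrow> 'a \<Rightarrow> real" where
  "biorth e n x = (THE a :: nat \<Rightarrow> real. (\<lambda>k. a k *\<^sub>R e k) sums x) n"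

definition supp :: "(nat \<Rightarrow> 'a::banach) \<Rightarrow> 'a \<Rightarrow> nat set" where
  "supp e x = {n. biorth e n x \<noteq> 0}"

definition weight :: "(nat \<Rightarrow> real) \<Rightarrow> bool" where
  "weight w \<longleftrightarrow> (\<forall>n. 0 < w n)"

definition signs :: "(nat \<Rightarrow> real) set" where
  "signs = {\<epsilon>. \<forall>i. \<epsilon> i = 1 \<or> \<epsilon> i = -1}"

definition signed_sum :: "(nat \<Rightarrow> 'a::banach) \<Rightarrow> (nat \<Rightarrow> real) \<Rightarrow> nat set \<Rightarrow> 'a" where
  "signed_sum e \<epsilon> A = (\<Sum>i\<in>A. \<epsilon> i *\<^sub>R e i)"

definition set_less :: "nat set \<Rightarrow> nat set \<Rightarrow> bool" where
  "set_less A B \<longleftrightarrow> (\<forall>a\<in>A. \<forall>b\<in>B. a < b)"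

(* The relation R is the condition imposed on the position of A and B.
   For a normalized basis the coefficients of x tend to 0,
   so the supremum is over a bounded set. *)
definition A_inequality ::
  "(nat set \<Rightarrow> nat set \<Rightarrow> bool) \<Rightarrow> real \<Rightarrow> (nat \<Rightarrow> real) \<Rightarrow> (nat \<Rightarrow> 'a::banach) \<Rightarrow> bool" where
  "A_inequality R C w e \<longleftrightarrow>
     (\<forall>x t. \<forall>\<epsilon>\<in>signs. \<forall>\<eta>\<in>signs. \<forall>A B.
        finite A \<and> finite B \<and> R A B \<and> sum w A \<le> sum w B \<and>
        supp e x \<inter> (A \<union> B) = {} \<and> (SUP j. \<bar>biorth e j x\<bar>) \<le> t \<longrightarrow>
        norm (x + t *\<^sub>R signed_sum e \<epsilon> A) \<le> C * norm (x + t *\<^sub>R signed_sum e \<eta> B))"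

definition property_A :: "(nat \<Rightarrow> real) \<Rightarrow> (nat \<Rightarrow> 'a::banach) \<Rightarrow> bool" where
  "property_A w e \<longleftrightarrow> (\<exists>C\<ge>1. A_inequality (\<lambda>A B. A \<inter> B = {}) C w e)"

definition left_property_A :: "(nat \<Rightarrow> real) \<Rightarrow> (nat \<Rightarrow> 'a::banach) \<Rightarrow> bool" where
  "left_property_A w e \<longleftrightarrow> (\<exists>C\<ge>1. A_inequality (\<lambda>A B. set_less A B) C w e)"

definition right_property_A :: "(nat \<Rightarrow> real) \<Rightarrow> (nat \<Rightarrow> 'a::banach) \<Rightarrow> bool" where
  "right_property_A w e \<longleftrightarrow> (\<exists>C\<ge>1. A_inequality (\<lambda>A B. set_less B A) C w e)"

end

(* By continuity it suffices to treat finitely supported x. Choose an interval {n..<m} beyond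
   A, B and the support of x with w{n..<m} <= w(A) <= w{n..<m+1}. The left property passes from A
   to {n..<m+1}, dropping e_m costs at most t, and the right property passes from {n..<m} to B.
   The cost t is absorbed by the right property with first set empty and second set {b}, b in B,
   which removes a single vector of B and gives t <= (1+C) * norm(x + t 1_B); so no bound on the
   biorthogonal functionals is required. *)
theory Submission
  imports Defs
begin

lemma abs_signs:
  assumes "\<epsilon> \<in> signs"
  shows "\<bar>\<epsilon> i\<bar> = 1"
proof -
  have "\<epsilon> i = 1 \<or> \<epsilon> i = -1"
    using assms by (simp add: signs_def)
  then show ?thesis by auto
qed

lemma schauder_basis_sums_biorth:
  assumes "schauder_basis e"
  shows "(\<lambda>n. biorth e n x *\<^sub>R e n) sums x"
proof -
  have "\<exists>!a :: nat \<Rightarrow> real. (\<lambda>n. a n *\<^sub>R e n) sums x"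
    using assms by (simp add: schauder_basis_def)
  from theI'[OF this] show ?thesis by (simp add: biorth_def)
qed

lemma schauder_basis_biorth_eqI:
  fixes a :: "nat \<Rightarrow> real"
  assumes "schauder_basis e" "(\<lambda>n. a n *\<^sub>R e n) sums x"
  shows "biorth e n x = a n"
proof -
  have "\<exists>!a :: nat \<Rightarrow> real. (\<lambda>n. a n *\<^sub>R e n) sums x"
    using assms by (simp add: schauder_basis_def)
  then have "(THE a :: nat \<Rightarrow> real. (\<lambda>n. a n *\<^sub>R e n) sums x) = a"
    by (rule the1_equality) (rule assms(2))
  then show ?thesis
    by (simp add: biorth_def)
qed

lemma biorth_finite_sum:
  assumes "schauder_basis e" "finite F"
  shows "biorth e n (\<Sum>i\<in>F. c i *\<^sub>R e i) = (if n \<in> F then c n else 0)"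
proof (rule schauder_basis_biorth_eqI[OF assms(1)])
  have "(\<lambda>n. (if n \<in> F then c n else 0) *\<^sub>R e n) = (\<lambda>n. if n \<in> F then c n *\<^sub>R e n else 0)"
    by (rule ext) simp
  then show "(\<lambda>n. (if n \<in> F then c n else 0) *\<^sub>R e n) sums (\<Sum>i\<in>F. c i *\<^sub>R e i)"
    using sums_If_finite_set[OF assms(2), of "\<lambda>n. c n *\<^sub>R e n"] by (simp only:)
qed

text \<open>A real \<open>SUP\<close> is an upper bound only for a bounded set. The terms of the
  convergent expansion tend to 0, hence are bounded, and normalization turns their norms into the
  coefficients.\<close>

lemma normalized_abs_biorth_le_SUP:
  assumes "schauder_basis e" "normalized e"
  shows "\<bar>biorth e i x\<bar> \<le> (SUP j. \<bar>biorth e j x\<bar>)"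
proof (rule cSUP_upper)
  have "(\<lambda>n. biorth e n x *\<^sub>R e n) \<longlonglongrightarrow> 0"
    using schauder_basis_sums_biorth[OF assms(1)] by (blast intro: summable_LIMSEQ_zero sums_summable)
  then have "Bseq (\<lambda>n. biorth e n x *\<^sub>R e n)"
    by (blast intro: convergent_imp_Bseq convergentI)
  then obtain K where "\<And>n. norm (biorth e n x *\<^sub>R e n) \<le> K"
    by (auto simp: Bseq_def)
  then have "\<bar>biorth e n x\<bar> \<le> K" for n
    using assms(2) by (simp add: normalized_def)
  then show "bdd_above (range (\<lambda>j. \<bar>biorth e j x\<bar>))"
    by (intro bdd_aboveI2)
qed simp

text \<open>Makes the hypothesis usable on finite sums: \<open>F\<close> need only contain the
  support, and since coefficients outside \<open>F\<close> vanish, the bound on \<open>F\<close>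
  together with \<open>0 \<le> t\<close> controls the supremum.\<close>

lemma A_inequality_finite_sumD:
  assumes "schauder_basis e" "A_inequality R C w e"
    and "finite F" "\<And>i. i \<in> F \<Longrightarrow> \<bar>c i\<bar> \<le> t" "0 \<le> t"
    and "\<epsilon> \<in> signs" "\<eta> \<in> signs" "finite A" "finite B" "R A B" "sum w A \<le> sum w B"
    and "F \<inter> (A \<union> B) = {}"
  shows "norm ((\<Sum>i\<in>F. c i *\<^sub>R e i) + t *\<^sub>R signed_sum e \<epsilon> A)
    \<le> C * norm ((\<Sum>i\<in>F. c i *\<^sub>R e i) + t *\<^sub>R signed_sum e \<eta> B)"
proof -
  let ?x = "\<Sum>i\<in>F. c i *\<^sub>R e i"
  have "supp e ?x \<inter> (A \<union> B) = {}"
    using assms(12) by (auto simp: supp_def biorth_finite_sum[OF assms(1,3)] split: if_splits)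
  moreover have "(SUP j. \<bar>biorth e j ?x\<bar>) \<le> t"
    using assms(4,5) by (intro cSUP_least) (auto simp: biorth_finite_sum[OF assms(1,3)])
  ultimately show ?thesis
    using assms(8-11)
    by (intro assms(2)[unfolded A_inequality_def, rule_format, OF assms(6,7)] conjI)
qed

lemma le_norm_add_signed_sum:
  assumes "schauder_basis e" "normalized e" "weight w"
    and "A_inequality (\<lambda>A B. set_less B A) C w e"
    and "finite F" "\<And>i. i \<in> F \<Longrightarrow> \<bar>c i\<bar> \<le> t" "0 \<le> t"
    and "\<eta> \<in> signs" "finite B" "B \<noteq> {}" "F \<inter> B = {}"
  shows "t \<le> (1 + C) * norm ((\<Sum>i\<in>F. c i *\<^sub>R e i) + t *\<^sub>R signed_sum e \<eta> B)"
proof -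
  from \<open>B \<noteq> {}\<close> obtain b where b: "b \<in> B" by blast
  \<comment> \<open>\<open>?z\<close> will be the full vector without its \<open>b\<close>-term. Its
    coefficients are still at most \<open>t\<close> in absolute value, so it may play the role of
    \<open>x\<close> in the right property.\<close>
  define G where "G = F \<union> (B - {b})"
  define d where "d i = (if i \<in> F then c i else t * \<eta> i)" for i
  let ?x = "\<Sum>i\<in>F. c i *\<^sub>R e i" and ?z = "\<Sum>i\<in>G. d i *\<^sub>R e i"
  have abs: "\<bar>\<eta> i\<bar> = 1" for i
    by (rule abs_signs[OF assms(8)])
  have "?z = (\<Sum>i\<in>F. d i *\<^sub>R e i) + (\<Sum>i\<in>B - {b}. d i *\<^sub>R e i)"
    unfolding G_def using assms(5,9,11) by (intro sum.union_disjoint) auto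
  also have "(\<Sum>i\<in>F. d i *\<^sub>R e i) = ?x"
    by (simp add: d_def)
  also have "(\<Sum>i\<in>B - {b}. d i *\<^sub>R e i) = t *\<^sub>R (\<Sum>i\<in>B - {b}. \<eta> i *\<^sub>R e i)"
    unfolding scaleR_sum_right using assms(11) by (intro sum.cong) (auto simp: d_def)
  finally have z: "?z + (t * \<eta> b) *\<^sub>R e b = ?x + t *\<^sub>R signed_sum e \<eta> B"
    using sum.remove[OF assms(9) b, of "\<lambda>i. \<eta> i *\<^sub>R e i"]
    by (simp add: signed_sum_def algebra_simps)
  \<comment> \<open>The position condition is vacuous for the empty set, and its weight 0 is below
    \<open>w b\<close>.\<close>
  have "norm (?z + t *\<^sub>R signed_sum e \<eta> {}) \<le> C * norm (?z + t *\<^sub>R signed_sum e \<eta> {b})"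
    using assms(3,5,9,11) b
    by (intro A_inequality_finite_sumD[OF assms(1,4)] assms)
      (auto simp: G_def d_def assms(6,7) abs_mult abs set_less_def weight_def less_imp_le)
  then have "norm ?z \<le> C * norm (?z + (t * \<eta> b) *\<^sub>R e b)"
    by (simp add: signed_sum_def)
  moreover have "norm ((t * \<eta> b) *\<^sub>R e b) = t"
    using assms(2,7) by (simp add: normalized_def abs_mult abs)
  \<comment> \<open>The removed term, of norm exactly \<open>t\<close>, is the full vector minus
    \<open>?z\<close>; the two norms contribute 1 and \<open>C\<close> to the constant.\<close>
  moreover have "norm ((t * \<eta> b) *\<^sub>R e b) \<le> norm (?z + (t * \<eta> b) *\<^sub>R e b) + norm ?z"
    by (metis add_diff_cancel_left' norm_triangle_ineq4)
  ultimately show ?thesis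
    unfolding z by (simp add: algebra_simps)
qed

lemma ex_interval_weight_between:
  fixes w :: "nat \<Rightarrow> real"
  assumes "filterlim (\<lambda>n. \<Sum>i<n. w i) at_top sequentially" "0 \<le> a"
  shows "\<exists>m. sum w {n..<m} \<le> a \<and> a \<le> sum w {n..<Suc m}"
proof -
  let ?P = "\<lambda>m. a \<le> sum w {n..<Suc m}"
  have "\<forall>\<^sub>F m in sequentially. a + sum w {..<n} \<le> sum w {..<m}"
    using assms(1) by (simp add: filterlim_at_top)
  then obtain N where N: "\<And>m. N \<le> m \<Longrightarrow> a + sum w {..<n} \<le> sum w {..<m}"
    by (auto simp: eventually_sequentially)
  \<comment> \<open>The index \<open>N + n\<close> lies beyond both the threshold \<open>N\<close>
    and the left end \<open>n\<close>, so the two intervals concatenate.\<close>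
  have "sum w {..<n} + sum w {n..<Suc (N + n)} = sum w {..<Suc (N + n)}"
    unfolding lessThan_atLeast0 by (rule sum.atLeastLessThan_concat) simp_all
  with N[of "Suc (N + n)"] have "?P (N + n)"
    by linarith
  then have least: "?P (LEAST m. ?P m)"
    by (rule LeastI)
  \<comment> \<open>If the least index is \<open>Suc k\<close>, failure of \<open>?P k\<close>
    bounds exactly this interval. If it is 0, the interval is empty and \<open>0 \<le> a\<close>
    suffices.\<close>
  have "sum w {n..<LEAST m. ?P m} \<le> a"
  proof (cases "LEAST m. ?P m")
    case (Suc k)
    then have "\<not> ?P k"
      by (intro not_less_Least) simp
    with Suc show ?thesis
      by simp
  qed (use assms(2) in simp)
  with least show ?thesis
    by blast
qed

lemma norm_signed_sum_atLeastLessThan_Suc_diff: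
  assumes "normalized e" "\<epsilon> \<in> signs"
  shows "norm (signed_sum e \<epsilon> {n..<Suc m} - signed_sum e \<epsilon> {n..<m}) \<le> 1"
proof -
  have "norm (\<epsilon> m *\<^sub>R e m) = 1"
    using assms by (simp add: normalized_def abs_signs)
  then show ?thesis
    \<comment> \<open>For \<open>m < n\<close> both intervals are empty and the difference is 0;
      otherwise it is the single term at \<open>m\<close>.\<close>
    by (cases "n \<le> m") (simp_all add: signed_sum_def sum.atLeastLessThan_Suc)
qed

lemma left_right_A_inequality_finite_sum:
  assumes e: "schauder_basis e" "normalized e" and w: "weight w"
    "filterlim (\<lambda>n. \<Sum>i<n. w i) at_top sequentially"
    and C: "1 \<le> C" "A_inequality (\<lambda>A B. set_less A B) C w e"
    and D: "1 \<le> D" "A_inequality (\<lambda>A B. set_less B A) D w e"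
    and F: "finite F" "\<And>i. i \<in> F \<Longrightarrow> \<bar>c i\<bar> \<le> t" "0 \<le> t"
    and AB: "\<epsilon> \<in> signs" "\<eta> \<in> signs" "finite A" "finite B" "sum w A \<le> sum w B"
      "F \<inter> (A \<union> B) = {}"
  shows "norm ((\<Sum>i\<in>F. c i *\<^sub>R e i) + t *\<^sub>R signed_sum e \<epsilon> A)
    \<le> C * (1 + 2 * D) * norm ((\<Sum>i\<in>F. c i *\<^sub>R e i) + t *\<^sub>R signed_sum e \<eta> B)"
proof (cases "B = {}")
  case True
  \<comment> \<open>With \<open>B\<close> empty there is no vector available to absorb
    \<open>t\<close>, but positive weights force \<open>A\<close> to be empty too, and both sides
    involve the same vector.\<close>
  have "A = {}"
  proof (rule ccontr)
    assume "A \<noteq> {}"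
    then have "0 < sum w A"
      using AB(3) w(1) by (intro sum_pos) (auto simp: weight_def)
    with AB(5) True show False by simp
  qed
  moreover have "1 \<le> C * (1 + 2 * D)"
    using C(1) D(1) mult_mono[of 1 C 1 "1 + 2 * D"] by simp
  ultimately show ?thesis
    using True mult_right_mono[of 1 "C * (1 + 2 * D)" "norm (\<Sum>i\<in>F. c i *\<^sub>R e i)"]
    by (simp add: signed_sum_def)
next
  case False
  let ?x = "\<Sum>i\<in>F. c i *\<^sub>R e i" and ?one = "\<lambda>_::nat. 1::real"
  let ?y = "norm (?x + t *\<^sub>R signed_sum e \<eta> B)"
  have one: "?one \<in> signs"
    by (simp add: signs_def)
  have "finite (F \<union> A \<union> B)"
    using F(1) AB(3,4) by simp
  \<comment> \<open>Bounding \<open>F\<close> as well keeps the interval off the support of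
    \<open>?x\<close>, as both properties require.\<close>
  then obtain n where n: "\<And>i. i \<in> F \<union> A \<union> B \<Longrightarrow> i < n"
    by (auto simp: finite_nat_set_iff_bounded)
  have "0 \<le> sum w A"
    using w(1) by (intro sum_nonneg) (simp add: weight_def less_imp_le)
  then obtain m where m: "sum w {n..<m} \<le> sum w A" "sum w A \<le> sum w {n..<Suc m}"
    using ex_interval_weight_between[OF w(2)] by blast
  let ?u = "signed_sum e ?one {n..<m}" and ?v = "signed_sum e ?one {n..<Suc m}"
  have "norm (?x + t *\<^sub>R signed_sum e \<epsilon> A) \<le> C * norm (?x + t *\<^sub>R ?v)"
    using m AB(6) n
    by (intro A_inequality_finite_sumD[OF e(1) C(2)] F AB one)
      (force simp: set_less_def simp del: sum.op_ivl_Suc)+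
  also have "\<dots> \<le> C * (norm (?x + t *\<^sub>R ?u) + t)"
  proof -
    have "norm (?x + t *\<^sub>R ?v) \<le> norm (?x + t *\<^sub>R ?u) + norm (t *\<^sub>R (?v - ?u))"
      using norm_triangle_ineq[of "?x + t *\<^sub>R ?u" "t *\<^sub>R (?v - ?u)"] by (simp add: algebra_simps)
    also have "norm (t *\<^sub>R (?v - ?u)) \<le> t"
      using norm_signed_sum_atLeastLessThan_Suc_diff[OF e(2) one] F(3)
      by (simp add: mult_left_le)
    finally show ?thesis
      using C(1) by (intro mult_left_mono) auto
  qed
  \<comment> \<open>The factor \<open>1 + 2 * D\<close> arises here: \<open>D\<close> from passing
    from the interval to \<open>B\<close>, and \<open>1 + D\<close> from absorbing
    \<open>t\<close>.\<close>
  also have "\<dots> \<le> C * (D * ?y + (1 + D) * ?y)"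
  proof -
    have "norm (?x + t *\<^sub>R ?u) \<le> D * ?y"
      using m AB(5,6) n
      by (intro A_inequality_finite_sumD[OF e(1) D(2)] F AB one) (force simp: set_less_def)+
    moreover have "t \<le> (1 + D) * ?y"
      using AB(6) by (intro le_norm_add_signed_sum[OF e w(1) D(2)] F AB False) auto
    ultimately show ?thesis
      using C(1) by (intro mult_left_mono add_mono) auto
  qed
  finally show ?thesis
    by (simp add: algebra_simps)
qed

theorem theorem3p18:
  fixes e :: "nat \<Rightarrow> 'a::banach" and w :: "nat \<Rightarrow> real"
  assumes "schauder_basis e" and "normalized e"
    and "weight w"
    and "filterlim (\<lambda>n. \<Sum>i<n. w i) at_top sequentially"
    and "bdd_above (range w)"
    and "left_property_A w e" and "right_property_A w e"
  shows "property_A w e"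
proof -
  obtain C where C: "1 \<le> C" "A_inequality (\<lambda>A B. set_less A B) C w e"
    using assms(6) by (auto simp: left_property_A_def)
  obtain D where D: "1 \<le> D" "A_inequality (\<lambda>A B. set_less B A) D w e"
    using assms(7) by (auto simp: right_property_A_def)
  let ?K = "C * (1 + 2 * D)"
  have "1 \<le> ?K"
    using C(1) D(1) mult_mono[of 1 C 1 "1 + 2 * D"] by simp
  moreover have "A_inequality (\<lambda>A B. A \<inter> B = {}) ?K w e"
    unfolding A_inequality_def
  proof (intro allI ballI impI, elim conjE)
    fix x t \<epsilon> \<eta> A B
    assume AB: "\<epsilon> \<in> signs" "\<eta> \<in> signs" "finite A" "finite B" "sum w A \<le> sum w B"
      "supp e x \<inter> (A \<union> B) = {}" and t: "(SUP j. \<bar>biorth e j x\<bar>) \<le> t"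
    have le: "\<bar>biorth e i x\<bar> \<le> t" for i
      using normalized_abs_biorth_le_SUP[OF assms(1,2)] t by (rule order_trans)
    have t0: "0 \<le> t"
      using le[of 0] by linarith
    \<comment> \<open>Partial sums inherit the coefficients of \<open>x\<close>, so the same
      \<open>t\<close> is admissible for every \<open>n\<close>.\<close>
    define s where "s n = (\<Sum>i<n. biorth e i x *\<^sub>R e i)" for n
    have lim: "s \<longlonglongrightarrow> x"
      using schauder_basis_sums_biorth[OF assms(1)] by (simp add: sums_def s_def[abs_def])
    have "norm (s n + t *\<^sub>R signed_sum e \<epsilon> A) \<le> ?K * norm (s n + t *\<^sub>R signed_sum e \<eta> B)" for n
    proof -
      \<comment> \<open>The range \<open>{..<n}\<close> may meet \<open>A\<close> or
        \<open>B\<close>; discarding the zero coefficients makes the index set disjoint from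
        both.\<close>
      have "s n = (\<Sum>i\<in>{..<n} \<inter> supp e x. biorth e i x *\<^sub>R e i)"
        unfolding s_def by (rule sum.mono_neutral_right) (auto simp: supp_def)
      then show ?thesis
        using AB(6)
        by (simp only:) (intro left_right_A_inequality_finite_sum[OF assms(1-4) C D] le t0 AB; auto)
    qed
    \<comment> \<open>Since \<open>?K\<close> does not depend on \<open>n\<close>, the inequality
      survives the limit.\<close>
    then show "norm (x + t *\<^sub>R signed_sum e \<epsilon> A) \<le> ?K * norm (x + t *\<^sub>R signed_sum e \<eta> B)"
      by (intro LIMSEQ_le[of "\<lambda>n. norm (s n + t *\<^sub>R signed_sum e \<epsilon> A)" _
            "\<lambda>n. ?K * norm (s n + t *\<^sub>R signed_sum e \<eta> B)"])
        (auto intro!: tendsto_intros lim)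
  qed
  ultimately show ?thesis
    unfolding property_A_def by blast
qed

end
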